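(* For $b\in\mathbb R$ let $w_b(x)=e^{-x^2+2bx}$, $x\in(-\infty,\infty)$, be the shifted Hermite weight. If $a,b\in\mathbb R$ and $a\neq b$, then $w_b$ is not a Darboux transformation of $w_a$.
   Context: Differential operators $D=\sum_{j}\partial^jf_j(x)$ with $f_j\in\mathbb C[x]$, $\partial=\frac{d}{dx}$, act on the right on functions: $p(x)\cdot D=\sum_j p^{(j)}(x)f_j(x)$; products satisfy $p\cdot(D_1D_2)=(p\cdot D_1)\cdot D_2$. The algebra of these operators is denoted $\Omega[x]$. For a scalar weight $w$ on an interval (positive almost everywhere, smooth, with finite moments) with monic orthogonal polynomials $p_n$, $\mathcal D(w)$ is the algebra of all $D\in\Omega[x]$ such that for every $n\ge 0$, $p_n\cdot D=\Lambda_n(D)p_n$ for some $\Lambda_n(D)\in\mathbb C$. An operator $\mathcal V\in\Omega[x]$ is degree-preserving if $\deg(p\cdot\mathcal V)=\deg p$ for all $p\in\mathbb C[x]$. For scalar weights $w,\widetilde w$ on the same interval with monic orthogonal polynomials $p_n,\widetilde p_n$, $\widetilde w$ is a Darboux transformation of $w$ if there is $D\in\mathcal D(w)$ with $D=\mathcal V\mathcal N$, where $\mathcal V,\mathcal N\in\Omega[x]$ are degree-preserving and $p_n\cdot\mathcal V=A_n\widetilde p_n$ for all $n\in\mathbb N_0$, for some $A_n\in\mathbb C$. *)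

theory Defs
  imports "HOL-Probability.Distributions" "HOL-Computational_Algebra.Polynomial"
begin

section \<open>The algebra of differential operators\<close>

text \<open>The operator \<open>\<Sum>j. \<partial>^j f_j(x)\<close> is represented by its coefficient sequence, so that
  \<open>f_j\<close> is \<open>coeff D j\<close>. The ring multiplication of \<open>complex poly poly\<close> is not the
  product of operators, which is \<open>diffop_mult\<close> below.\<close>

type_synonym diffop = "complex poly poly"

definition diffop_app :: "complex poly \<Rightarrow> diffop \<Rightarrow> complex poly" (infixl \<open>\<bullet>\<^sub>\<Omega>\<close> 73) where
  "p \<bullet>\<^sub>\<Omega> D = (\<Sum>j\<le>degree D. (pderiv ^^ j) p * coeff D j)"

text \<open>The Leibniz rule gives
  \<open>(\<partial>^i f) (\<partial>^j g) = \<Sum>k\<le>j. (j choose k) \<partial>^(i+k) f^(j-k) g\<close>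
  for operators acting from the right.\<close>

definition diffop_mult :: "diffop \<Rightarrow> diffop \<Rightarrow> diffop" (infixl \<open>*\<^sub>\<Omega>\<close> 75) where
  "D *\<^sub>\<Omega> E = (\<Sum>i\<le>degree D. \<Sum>j\<le>degree E. \<Sum>k\<le>j.
     monom (smult (of_nat (j choose k)) ((pderiv ^^ (j - k)) (coeff D i) * coeff E j)) (i + k))"

text \<open>The condition \<open>p \<bullet>\<^sub>\<Omega> V \<noteq> 0\<close> is needed because \<open>degree 0 = degree 1\<close> in the library.\<close>

definition degree_preserving :: "diffop \<Rightarrow> bool" where
  "degree_preserving V \<longleftrightarrow> (\<forall>p. p \<noteq> 0 \<longrightarrow> p \<bullet>\<^sub>\<Omega> V \<noteq> 0 \<and> degree (p \<bullet>\<^sub>\<Omega> V) = degree p)"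

lemma diffop_app_bound:
  assumes "degree D \<le> N"
  shows "p \<bullet>\<^sub>\<Omega> D = (\<Sum>j\<le>N. (pderiv ^^ j) p * coeff D j)"
  unfolding diffop_app_def
  by (rule sum.mono_neutral_left) (use assms in \<open>auto simp: coeff_eq_0 not_le\<close>)

lemma diffop_app_add: "p \<bullet>\<^sub>\<Omega> (D + E) = p \<bullet>\<^sub>\<Omega> D + p \<bullet>\<^sub>\<Omega> E"
proof -
  define N where "N = max (degree D) (degree E)"
  have "degree D \<le> N" "degree E \<le> N" "degree (D + E) \<le> N"
    by (auto simp: N_def degree_add_le_max)
  then show ?thesis
    by (simp add: diffop_app_bound[of _ N] algebra_simps sum.distrib)
qed

lemma diffop_app_0 [simp]: "p \<bullet>\<^sub>\<Omega> 0 = 0"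
  by (simp add: diffop_app_def)

lemma diffop_app_sum: "p \<bullet>\<^sub>\<Omega> (\<Sum>i\<in>A. f i) = (\<Sum>i\<in>A. p \<bullet>\<^sub>\<Omega> f i)"
  by (induction A rule: infinite_finite_induct) (auto simp: diffop_app_add)

lemma diffop_app_monom: "p \<bullet>\<^sub>\<Omega> monom f n = (pderiv ^^ n) p * f"
proof -
  have "p \<bullet>\<^sub>\<Omega> monom f n = (\<Sum>j\<le>n. (pderiv ^^ j) p * coeff (monom f n) j)"
    by (rule diffop_app_bound) (rule degree_monom_le)
  also have "\<dots> = (\<Sum>j\<le>n. if j = n then (pderiv ^^ n) p * f else 0)"
    by (rule sum.cong) auto
  finally show ?thesis by simp
qed

lemma higher_pderiv_mult:
  fixes p q :: "complex poly"
  shows "(pderiv ^^ n) (p * q) =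
    (\<Sum>k\<le>n. smult (of_nat (n choose k)) ((pderiv ^^ k) p * (pderiv ^^ (n - k)) q))"
proof (induction n)
  case (Suc n)
  let ?t = "\<lambda>i j. (pderiv ^^ i) p * (pderiv ^^ j) q"
  have "(pderiv ^^ Suc n) (p * q) =
      (\<Sum>k\<le>n. smult (of_nat (n choose k)) (?t (Suc k) (n - k)))
    + (\<Sum>k\<le>n. smult (of_nat (n choose k)) (?t k (Suc n - k)))"
    by (simp add: Suc higher_pderiv_sum[of 1, simplified] pderiv_smult pderiv_mult sum.distrib[symmetric]
        smult_add_right Suc_diff_le mult.commute add.commute)
  also have "(\<Sum>k\<le>n. smult (of_nat (n choose k)) (?t k (Suc n - k))) =
      (\<Sum>k\<le>Suc n. smult (of_nat (n choose k)) (?t k (Suc n - k)))"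
    by (simp add: binomial_eq_0)
  also have "\<dots> = ?t 0 (Suc n) +
      (\<Sum>k\<le>n. smult (of_nat (n choose Suc k)) (?t (Suc k) (n - k)))"
    by (subst sum.atMost_Suc_shift) simp
  finally have "(pderiv ^^ Suc n) (p * q) = ?t 0 (Suc n) +
      (\<Sum>k\<le>n. smult (of_nat (Suc n choose Suc k)) (?t (Suc k) (n - k)))"
    by (simp add: sum.distrib smult_add_left algebra_simps)
  also have "\<dots> = (\<Sum>k\<le>Suc n. smult (of_nat (Suc n choose k)) (?t k (Suc n - k)))"
    by (subst sum.atMost_Suc_shift) simp
  finally show ?case .
qed simp

theorem diffop_app_mult: "p \<bullet>\<^sub>\<Omega> (D *\<^sub>\<Omega> E) = (p \<bullet>\<^sub>\<Omega> D) \<bullet>\<^sub>\<Omega> E"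
proof -
  have "(p \<bullet>\<^sub>\<Omega> D) \<bullet>\<^sub>\<Omega> E =
      (\<Sum>j\<le>degree E. \<Sum>i\<le>degree D. (pderiv ^^ j) ((pderiv ^^ i) p * coeff D i) * coeff E j)"
    unfolding diffop_app_def by (simp add: higher_pderiv_sum sum_distrib_right)
  also have "\<dots> = (\<Sum>i\<le>degree D. \<Sum>j\<le>degree E.
      (pderiv ^^ j) ((pderiv ^^ i) p * coeff D i) * coeff E j)"
    by (rule sum.swap)
  also have "\<dots> = p \<bullet>\<^sub>\<Omega> (D *\<^sub>\<Omega> E)"
    unfolding diffop_mult_def diffop_app_sum diffop_app_monom higher_pderiv_mult sum_distrib_right
    by (intro sum.cong refl) (simp add: funpow_add[symmetric] add.commute mult.assoc
        flip: funpow_add o_apply[of "pderiv ^^ _" "pderiv ^^ _"])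
  finally show ?thesis by simp
qed


section \<open>Weights and their monic orthogonal polynomials\<close>

definition scalar_weight :: "real set \<Rightarrow> (real \<Rightarrow> real) \<Rightarrow> bool" where
  "scalar_weight I w \<longleftrightarrow>
     open I \<and> is_interval I \<and> I \<noteq> {} \<and>
     (AE x in lborel. x \<in> I \<longrightarrow> w x > 0) \<and>
     (\<forall>k. \<forall>x\<in>I. ((deriv ^^ k) w) differentiable (at x)) \<and>
     (\<forall>n. set_integrable lborel I (\<lambda>x. x ^ n * w x))"

definition weight_inner :: "real set \<Rightarrow> (real \<Rightarrow> real) \<Rightarrow> complex poly \<Rightarrow> complex poly \<Rightarrow> complex" where
  "weight_inner I w p q = set_lebesgue_integral lborel I
     (\<lambda>x. poly p (complex_of_real x) * cnj (poly q (complex_of_real x)) * complex_of_real (w x))"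

definition is_monic_orthogonal :: "real set \<Rightarrow> (real \<Rightarrow> real) \<Rightarrow> (nat \<Rightarrow> complex poly) \<Rightarrow> bool" where
  "is_monic_orthogonal I w P \<longleftrightarrow>
     (\<forall>n. degree (P n) = n \<and> lead_coeff (P n) = 1) \<and>
     (\<forall>m n. m \<noteq> n \<longrightarrow> weight_inner I w (P m) (P n) = 0)"

definition monic_orthogonal :: "real set \<Rightarrow> (real \<Rightarrow> real) \<Rightarrow> nat \<Rightarrow> complex poly" where
  "monic_orthogonal I w = (THE P. is_monic_orthogonal I w P)"

lemma weight_poly_integrable:
  assumes "scalar_weight I w"
  shows "set_integrable lborel I (\<lambda>x. poly p (complex_of_real x) * complex_of_real (w x))"
proof -
  have m: "set_integrable lborel I (\<lambda>x. complex_of_real (x ^ n * w x))" for n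
  proof -
    have "integrable lborel (\<lambda>x. complex_of_real (indicat_real I x *\<^sub>R (x ^ n * w x)))"
      using assms unfolding scalar_weight_def set_integrable_def
      by (intro integrable_of_real) auto
    then show ?thesis
      unfolding set_integrable_def by (simp add: scaleR_conv_of_real)
  qed
  have "set_integrable lborel I (\<lambda>x. \<Sum>i\<le>degree p. coeff p i * complex_of_real (x ^ i * w x))"
    unfolding set_integrable_def scaleR_sum_right
    by (intro Bochner_Integration.integrable_sum)
       (use m in \<open>auto simp: set_integrable_def intro: integrable_mult_right
          simp flip: mult_scaleR_right\<close>)
  then show ?thesis
    by (simp add: poly_altdef sum_distrib_right mult.assoc)
qed

lemma weight_inner_alt:
  "weight_inner I w p q = set_lebesgue_integral lborel I
     (\<lambda>x. poly (p * map_poly cnj q) (complex_of_real x) * complex_of_real (w x))"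
  unfolding weight_inner_def by simp

lemma weight_inner_add_left:
  assumes "scalar_weight I w"
  shows "weight_inner I w (p + q) r = weight_inner I w p r + weight_inner I w q r"
  unfolding weight_inner_alt using weight_poly_integrable[OF assms]
  by (subst set_integral_add(2)[symmetric]) (auto simp: algebra_simps simp del: poly_mult)

lemma weight_inner_smult_left: "weight_inner I w (smult c p) r = c * weight_inner I w p r"
  unfolding weight_inner_def by (simp flip: set_integral_mult_right add: mult.assoc)

lemma weight_inner_cnj: "weight_inner I w q p = cnj (weight_inner I w p q)"
proof -
  have "cnj (weight_inner I w p q) = integral\<^sup>L lborel (\<lambda>x. cnj (indicat_real I x *\<^sub>R
    (poly p (complex_of_real x) * cnj (poly q (complex_of_real x)) * complex_of_real (w x))))"
    unfolding weight_inner_def set_lebesgue_integral_def by (rule Bochner_Integration.integral_cnj[symmetric])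
  also have "\<dots> = weight_inner I w q p"
    unfolding weight_inner_def set_lebesgue_integral_def
    by (intro Bochner_Integration.integral_cong) (auto simp: mult_ac)
  finally show ?thesis by simp
qed

lemma weight_inner_0_left [simp]: "weight_inner I w 0 r = 0"
  by (simp add: weight_inner_def)

lemma weight_inner_sum_left:
  assumes "scalar_weight I w"
  shows "weight_inner I w (\<Sum>i\<in>A. f i) r = (\<Sum>i\<in>A. weight_inner I w (f i) r)"
  by (induction A rule: infinite_finite_induct) (auto simp: weight_inner_add_left[OF assms])

lemma weight_inner_self_eq_0:
  assumes w: "scalar_weight I w" and 0: "weight_inner I w p p = 0"
  shows "p = 0"
proof (rule ccontr)
  assume "p \<noteq> 0"
  let ?f = "\<lambda>x. indicat_real I x *\<^sub>R (cmod (poly p (complex_of_real x)) ^ 2 * w x)"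
  have eq: "complex_of_real (?f x) = indicat_real I x *\<^sub>R
      (poly (p * map_poly cnj p) (complex_of_real x) * complex_of_real (w x))" for x
    by (simp add: scaleR_conv_of_real complex_norm_square[symmetric] del: of_real_power)
  have "integrable lborel (\<lambda>x. complex_of_real (?f x))"
    unfolding eq using weight_poly_integrable[OF w, of "p * map_poly cnj p"]
    unfolding set_integrable_def .
  then have int: "integrable lborel ?f"
    using integrable_Re by fastforce
  have "complex_of_real (integral\<^sup>L lborel ?f) = weight_inner I w p p"
    unfolding integral_complex_of_real[symmetric] eq weight_inner_alt set_lebesgue_integral_def ..
  with 0 have z: "integral\<^sup>L lborel ?f = 0" by simp
  have pos: "AE x in lborel. x \<in> I \<longrightarrow> w x > 0"
    using w by (simp add: scalar_weight_def)
  have "AE x in lborel. 0 \<le> ?f x"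
    using pos by eventually_elim (auto simp: indicator_def)
  with int z have "AE x in lborel. ?f x = 0"
    by (simp add: integral_nonneg_eq_0_iff_AE)
  with pos have ae: "AE x in lborel. x \<in> I \<longrightarrow> poly p (complex_of_real x) = 0"
    by eventually_elim (auto simp: indicator_def)
  have "finite {x. poly p (complex_of_real x) = 0}"
    using finite_vimageI[OF poly_roots_finite[OF \<open>p \<noteq> 0\<close>], of complex_of_real]
    by (simp add: vimage_def inj_of_real)
  then have "AE x in lborel. x \<notin> {x. poly p (complex_of_real x) = 0}"
    by (intro AE_not_in finite_imp_null_set_lborel)
  with ae have "AE x in lborel. x \<notin> I"
    by eventually_elim auto
  then have "emeasure lborel I = 0"
    using w by (subst (asm) AE_iff_measurable[of I]) (auto simp: scalar_weight_def)
  moreover have "open I" "I \<noteq> {}" using w by (auto simp: scalar_weight_def)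
  ultimately show False
    using open_not_negligible[of I]
    by (auto simp: negligible_iff_emeasure0 emeasure_completion)
qed

lemma monic_expand:
  fixes P :: "nat \<Rightarrow> complex poly"
  assumes P: "\<And>n. degree (P n) = n \<and> lead_coeff (P n) = 1"
  shows "degree r < n \<or> r = 0 \<Longrightarrow> \<exists>c. r = (\<Sum>k<n. smult (c k) (P k))"
proof (induction n arbitrary: r)
  case (Suc n)
  define s where "s = r - smult (coeff r n) (P n)"
  have c: "coeff (P n) n = 1" using P[of n] by metis
  have "degree s < n \<or> s = 0"
  proof (rule ccontr)
    assume a: "\<not> (degree s < n \<or> s = 0)"
    have "degree s \<le> n"
      unfolding s_def using Suc.prems P[of n]
      by (intro degree_diff_le) (auto intro: order.trans[OF degree_smult_le])
    with a have "degree s = n" by auto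
    moreover have "coeff s n = 0" by (simp add: s_def c)
    ultimately show False using a by (metis leading_coeff_0_iff)
  qed
  from Suc.IH[OF this] obtain d where d: "s = (\<Sum>k<n. smult (d k) (P k))" ..
  have "r = (\<Sum>k<Suc n. smult ((d(n := coeff r n)) k) (P k))"
    using d by (simp add: s_def algebra_simps)
  then show ?case by blast
qed auto

lemma is_monic_orthogonal_lower:
  assumes w: "scalar_weight I w" and P: "is_monic_orthogonal I w P"
    and r: "degree r < n \<or> r = 0"
  shows "weight_inner I w r (P n) = 0"
proof -
  from P have "\<And>n. degree (P n) = n \<and> lead_coeff (P n) = 1"
    unfolding is_monic_orthogonal_def by blast
  from monic_expand[of P, OF this r] obtain c where "r = (\<Sum>k<n. smult (c k) (P k))" ..
  then show ?thesis
    using P by (auto simp: weight_inner_sum_left[OF w] weight_inner_smult_left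
        is_monic_orthogonal_def)
qed

lemma is_monic_orthogonal_unique:
  assumes w: "scalar_weight I w" and P: "is_monic_orthogonal I w P" and Q: "is_monic_orthogonal I w Q"
  shows "P = Q"
proof
  fix n
  let ?d = "P n - Q n"
  have PQ: "degree (P n) = n" "coeff (P n) n = 1" "degree (Q n) = n" "coeff (Q n) n = 1"
    using P Q unfolding is_monic_orthogonal_def by metis+
  have d: "degree ?d < n \<or> ?d = 0"
  proof (rule ccontr)
    assume a: "\<not> (degree ?d < n \<or> ?d = 0)"
    have "degree ?d \<le> n" using PQ by (intro degree_diff_le) auto
    with a have "degree ?d = n" by auto
    moreover have "coeff ?d n = 0" by (simp add: PQ)
    ultimately show False using a by (metis leading_coeff_0_iff)
  qed
  have "weight_inner I w ?d (P n) = 0" "weight_inner I w ?d (Q n) = 0"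
    using is_monic_orthogonal_lower[OF w _ d] P Q by auto
  then have "weight_inner I w (P n) ?d = 0" "weight_inner I w (Q n) ?d = 0"
    using weight_inner_cnj by (metis complex_cnj_zero)+
  moreover have "weight_inner I w ?d ?d = weight_inner I w (P n) ?d + (- 1) * weight_inner I w (Q n) ?d"
    by (simp flip: weight_inner_smult_left weight_inner_add_left[OF w])
  ultimately have "weight_inner I w ?d ?d = 0" by simp
  then show "P n = Q n" using weight_inner_self_eq_0[OF w] by fastforce
qed

fun gram_schmidt :: "real set \<Rightarrow> (real \<Rightarrow> real) \<Rightarrow> nat \<Rightarrow> complex poly" where
  "gram_schmidt I w n = monom 1 n - (\<Sum>k<n. smult (weight_inner I w (monom 1 n) (gram_schmidt I w k) /
     weight_inner I w (gram_schmidt I w k) (gram_schmidt I w k)) (gram_schmidt I w k))"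

declare gram_schmidt.simps [simp del]

lemma gram_schmidt_monic:
  "degree (gram_schmidt I w n) = n \<and> lead_coeff (gram_schmidt I w n) = 1"
proof (induction n rule: less_induct)
  case (less n)
  let ?s = "\<Sum>k<n. smult (weight_inner I w (monom 1 n) (gram_schmidt I w k) /
     weight_inner I w (gram_schmidt I w k) (gram_schmidt I w k)) (gram_schmidt I w k)"
  have c: "coeff ?s i = 0" if "i \<ge> n" for i
    unfolding coeff_sum using less that by (intro sum.neutral) (auto intro!: coeff_eq_0)
  have cg: "coeff (gram_schmidt I w n) i = (if i = n then 1 else 0)" if "i \<ge> n" for i
    using c[OF that] by (subst gram_schmidt.simps) auto
  have "degree (gram_schmidt I w n) \<le> n"
    by (rule degree_le) (use cg in auto)
  moreover have "degree (gram_schmidt I w n) \<ge> n"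
    by (rule le_degree) (use cg[of n] in auto)
  ultimately show ?case using cg[of n] by auto
qed

lemma gram_schmidt_orthogonal:
  assumes w: "scalar_weight I w"
  shows "m < n \<Longrightarrow> weight_inner I w (gram_schmidt I w n) (gram_schmidt I w m) = 0"
proof (induction n arbitrary: m rule: less_induct)
  case (less n)
  let ?g = "gram_schmidt I w"
  let ?c = "\<lambda>k. weight_inner I w (monom 1 n) (?g k) / weight_inner I w (?g k) (?g k)"
  have o: "weight_inner I w (?g k) (?g m) = 0" if "k < n" "k \<noteq> m" for k
    using less.IH[of k m] less.IH[of m k] less.prems that weight_inner_cnj[of I w "?g k" "?g m"]
    by (cases "k < m") auto
  have nz: "weight_inner I w (?g m) (?g m) \<noteq> 0"
    using weight_inner_self_eq_0[OF w, of "?g m"] gram_schmidt_monic[of I w m] by auto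
  have "?g n = monom 1 n + smult (- 1) (\<Sum>k<n. smult (?c k) (?g k))"
    by (subst gram_schmidt.simps) simp
  then have "weight_inner I w (?g n) (?g m) = weight_inner I w (monom 1 n) (?g m)
      + (- 1) * (\<Sum>k<n. ?c k * weight_inner I w (?g k) (?g m))"
    by (simp only: weight_inner_add_left[OF w] weight_inner_smult_left weight_inner_sum_left[OF w])
  also have "(\<Sum>k<n. ?c k * weight_inner I w (?g k) (?g m)) =
      (\<Sum>k<n. if k = m then weight_inner I w (monom 1 n) (?g m) else 0)"
    by (rule sum.cong) (use o nz in auto)
  finally show ?case using less.prems by simp
qed

theorem monic_orthogonal:
  assumes "scalar_weight I w"
  shows "is_monic_orthogonal I w (monic_orthogonal I w)"
proof -
  have g: "is_monic_orthogonal I w (gram_schmidt I w)"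
    unfolding is_monic_orthogonal_def
    using gram_schmidt_monic gram_schmidt_orthogonal[OF assms]
    by (metis complex_cnj_zero linorder_neqE_nat weight_inner_cnj)
  show ?thesis
    unfolding monic_orthogonal_def
    by (rule theI[of "is_monic_orthogonal I w", OF g]) (rule is_monic_orthogonal_unique[OF assms _ g])
qed


section \<open>Darboux transformations\<close>

definition weight_algebra :: "real set \<Rightarrow> (real \<Rightarrow> real) \<Rightarrow> diffop set" where
  "weight_algebra I w =
     {D. \<forall>n. \<exists>\<Lambda>. monic_orthogonal I w n \<bullet>\<^sub>\<Omega> D = smult \<Lambda> (monic_orthogonal I w n)}"

definition darboux_transformation :: "real set \<Rightarrow> (real \<Rightarrow> real) \<Rightarrow> (real \<Rightarrow> real) \<Rightarrow> bool" where
  \<comment> \<open>the second weight is a Darboux transformation of the first one\<close>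
  "darboux_transformation I w w' \<longleftrightarrow>
     (\<exists>D \<in> weight_algebra I w. \<exists>V N. D = V *\<^sub>\<Omega> N \<and> degree_preserving V \<and> degree_preserving N \<and>
        (\<forall>n. \<exists>A. monic_orthogonal I w n \<bullet>\<^sub>\<Omega> V = smult A (monic_orthogonal I w' n)))"


section \<open>Shifted Hermite weights\<close>

definition shifted_hermite :: "real \<Rightarrow> real \<Rightarrow> real" where
  "shifted_hermite b x = exp (- x\<^sup>2 + 2 * b * x)"

lemma shifted_hermite_deriv:
  "\<exists>q. (deriv ^^ k) (shifted_hermite b) = (\<lambda>x. poly q x * shifted_hermite b x)"
proof (induction k)
  case 0
  show ?case by (rule exI[of _ 1]) simp
next
  case (Suc k)
  then obtain q where q: "(deriv ^^ k) (shifted_hermite b) = (\<lambda>x. poly q x * shifted_hermite b x)" ..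
  have "deriv (\<lambda>x. poly q x * shifted_hermite b x) x =
      poly (pderiv q + q * [:2 * b, - 2:]) x * shifted_hermite b x" for x
    unfolding shifted_hermite_def
    by (rule DERIV_imp_deriv) (auto intro!: derivative_eq_intros simp: algebra_simps)
  then have "(deriv ^^ Suc k) (shifted_hermite b) =
      (\<lambda>x. poly (pderiv q + q * [:2 * b, - 2:]) x * shifted_hermite b x)"
    by (auto simp: q)
  then show ?case by blast
qed

lemma shifted_hermite_moment: "integrable lborel (\<lambda>x. x ^ n * shifted_hermite b x)"
proof -
  let ?g = "normal_density b (1 / sqrt 2)"
  have g: "shifted_hermite b x = exp (b\<^sup>2) * sqrt pi * ?g x" for x
  proof -
    have "- x\<^sup>2 + 2 * b * x = b\<^sup>2 + - (x - b)\<^sup>2"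
      by (simp add: power2_eq_square algebra_simps)
    then have "shifted_hermite b x = exp (b\<^sup>2) * exp (- (x - b)\<^sup>2)"
      unfolding shifted_hermite_def by (simp only: exp_add)
    then show ?thesis by (simp add: normal_density_def power_divide)
  qed
  have "integrable lborel (\<lambda>x. \<Sum>k\<le>n. (of_nat (n choose k) * b ^ (n - k) * exp (b\<^sup>2) * sqrt pi) *
      (?g x * (x - b) ^ k))"
    by (intro Bochner_Integration.integrable_sum integrable_mult_right integrable_normal_moment) auto
  also have "(\<lambda>x. \<Sum>k\<le>n. (of_nat (n choose k) * b ^ (n - k) * exp (b\<^sup>2) * sqrt pi) *
      (?g x * (x - b) ^ k)) = (\<lambda>x. x ^ n * shifted_hermite b x)"
  proof
    fix x
    have "x ^ n = (\<Sum>k\<le>n. of_nat (n choose k) * (x - b) ^ k * b ^ (n - k))"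
      using binomial_ring[of "x - b" b n] by simp
    then show "(\<Sum>k\<le>n. (of_nat (n choose k) * b ^ (n - k) * exp (b\<^sup>2) * sqrt pi) *
      (?g x * (x - b) ^ k)) = x ^ n * shifted_hermite b x"
      by (simp add: g sum_distrib_left sum_distrib_right mult_ac)
  qed
  finally show ?thesis .
qed

theorem scalar_weight_shifted_hermite: "scalar_weight UNIV (shifted_hermite b)"
proof -
  have "((deriv ^^ k) (shifted_hermite b)) differentiable (at x)" for k x
  proof -
    obtain q where "(deriv ^^ k) (shifted_hermite b) = (\<lambda>x. poly q x * shifted_hermite b x)"
      using shifted_hermite_deriv by blast
    moreover have "((\<lambda>x. poly q x * shifted_hermite b x) has_real_derivative
        (poly (pderiv q) x * exp (- x\<^sup>2 + 2 * b * x) +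
         poly q x * (exp (- x\<^sup>2 + 2 * b * x) * (- 2 * x + 2 * b)))) (at x)"
      unfolding shifted_hermite_def by (auto intro!: derivative_eq_intros)
    ultimately show ?thesis
      by (auto simp: real_differentiable_def)
  qed
  then show ?thesis
    using shifted_hermite_moment
    by (auto simp: scalar_weight_def set_integrable_def shifted_hermite_def[abs_def])
qed

end

theory Submission
  imports Defs "HOL-Real_Asymp.Real_Asymp"
begin

text \<open>
  The obstruction is already visible in the intertwining relation
  \<open>P\<^sub>n \<bullet> V = A\<^sub>n Q\<^sub>n\<close>, where \<open>P\<^sub>n\<close> and \<open>Q\<^sub>n\<close> are the monic orthogonal polynomials of
  \<open>w\<^sub>a\<close> and \<open>w\<^sub>b\<close>: a differential operator of finite order couples \<open>P\<^sub>n\<close> only to boundedly many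
  of its neighbours, whereas a shifted Hermite polynomial \<open>Q\<^sub>n\<close> has a component along every
  \<open>P\<^sub>k\<close> with \<open>k \<le> n\<close>. It suffices to look at the component along \<open>P\<^sub>0 = 1\<close>, that is, to compare
  the integrals of both sides against \<open>w\<^sub>a\<close>.

  Write \<open>L\<^sub>b p = \<integral> p w\<^sub>b\<close>. Since \<open>w\<^sub>b' = -2 (x - b) w\<^sub>b\<close>, integration by parts gives
  \<open>L\<^sub>b(p') = L\<^sub>b(2 (x - b) p)\<close> (\<open>hermite_integral_pderiv\<close>), and everything else follows from this
  identity. It moves all derivatives in \<open>p \<bullet> V\<close> away from \<open>p\<close>, so that
  \<open>L\<^sub>a(p \<bullet> V) = L\<^sub>a(p g)\<close> for a polynomial \<open>g\<close> depending only on \<open>V\<close> (\<open>hermite_integral_diffop\<close>);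
  hence \<open>L\<^sub>a(P\<^sub>n \<bullet> V) = 0\<close> as soon as \<open>n > deg g\<close>. It also proves the recursion
  \<open>Q\<^sub>n\<^sub>+\<^sub>1 = (x - b) Q\<^sub>n - Q\<^sub>n'/2\<close> (\<open>monic_orthogonal_shifted_hermite\<close>). Applying \<open>L\<^sub>a\<close> to
  the recursion, the part \<open>(x - a) Q\<^sub>n - Q\<^sub>n'/2\<close> integrates to zero, so that
  \<open>L\<^sub>a(Q\<^sub>n) = (a - b)\<^sup>n L\<^sub>a(1)\<close> (\<open>hermite_integral_hermite_poly\<close>), which never vanishes for
  \<open>a \<noteq> b\<close>. Therefore \<open>A\<^sub>n = 0\<close> for large \<open>n\<close>, which contradicts that \<open>V\<close> preserves degrees.
\<close>

section \<open>Integration by parts against a shifted Hermite weight\<close>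

abbreviation hermite_integral :: "real \<Rightarrow> complex poly \<Rightarrow> complex" where
  "hermite_integral b p \<equiv> weight_inner UNIV (shifted_hermite b) p 1"

lemma weight_inner_eq_mult_1: "weight_inner I w p q = weight_inner I w (p * map_poly cnj q) 1"
  by (simp add: weight_inner_alt)

lemma weight_inner_diff_left:
  assumes "scalar_weight I w"
  shows "weight_inner I w (p - q) r = weight_inner I w p r - weight_inner I w q r"
proof -
  have "weight_inner I w (p + smult (- 1) q) r = weight_inner I w p r + - 1 * weight_inner I w q r"
    by (simp only: weight_inner_add_left[OF assms] weight_inner_smult_left)
  then show ?thesis by simp
qed

lemmas hermite_integral_add = weight_inner_add_left[OF scalar_weight_shifted_hermite]
lemmas hermite_integral_diff = weight_inner_diff_left[OF scalar_weight_shifted_hermite]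

lemma poly_shifted_hermite_tendsto_0:
  assumes "F = at_top \<or> F = at_bot"
  shows "((\<lambda>x. poly p (complex_of_real x) * complex_of_real (shifted_hermite b x)) \<longlongrightarrow> 0) F"
proof -
  have "((\<lambda>x::real. x ^ i * exp (- x\<^sup>2 + 2 * b * x)) \<longlongrightarrow> 0) at_top"
       "((\<lambda>x::real. x ^ i * exp (- x\<^sup>2 + 2 * b * x)) \<longlongrightarrow> 0) at_bot" for i
    by real_asymp+
  then have "((\<lambda>x. x ^ i * shifted_hermite b x) \<longlongrightarrow> 0) F" for i
    using assms by (auto simp: shifted_hermite_def)
  from tendsto_of_real[OF this]
  have *: "((\<lambda>x. complex_of_real (x ^ i * shifted_hermite b x)) \<longlongrightarrow> 0) F" for i
    by simp
  have "((\<lambda>x. \<Sum>i\<le>degree p. coeff p i * complex_of_real (x ^ i * shifted_hermite b x)) \<longlongrightarrow>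
      (\<Sum>i\<le>degree p. coeff p i * 0)) F"
    by (intro tendsto_sum tendsto_mult_left *)
  then show ?thesis
    by (simp add: poly_altdef sum_distrib_right mult.assoc)
qed

text \<open>The fundamental theorem of calculus for \<open>p w\<^sub>b\<close>, whose derivative is
  \<open>(p' - 2 (x - b) p) w\<^sub>b\<close> and which decays at both ends.\<close>

lemma hermite_integral_pderiv:
  "hermite_integral b (pderiv p) = hermite_integral b ([:- 2 * of_real b, 2:] * p)"
proof -
  define q where "q = pderiv p - [:- 2 * of_real b, 2:] * p"
  let ?w = "\<lambda>x. complex_of_real (shifted_hermite b x)"
  let ?F = "\<lambda>x. poly p (complex_of_real x) * ?w x"
  let ?f = "\<lambda>x. poly q (complex_of_real x) * ?w x"
  have w: "(?w has_vector_derivative ?w x * of_real (2 * b - 2 * x)) (at x)" for x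
    unfolding has_real_derivative_iff_has_vector_derivative[symmetric] of_real_mult[symmetric]
    by (rule has_vector_derivative_of_real, unfold shifted_hermite_def)
       (auto intro!: derivative_eq_intros)
  have p: "((\<lambda>x. poly p (complex_of_real x)) has_vector_derivative
      poly (pderiv p) (complex_of_real x)) (at x)" for x
    by (rule has_vector_derivative_real_field) (rule poly_DERIV)
  have deriv: "(?F has_vector_derivative ?f x) (at x)" for x
    using has_vector_derivative_mult[OF p w] by (simp add: q_def algebra_simps)
  have cont: "isCont ?f x" for x
    unfolding shifted_hermite_def by (intro continuous_intros)
  have int: "set_integrable lborel UNIV ?f"
    by (rule weight_poly_integrable[OF scalar_weight_shifted_hermite])
  have "(LBINT x=-\<infinity>..\<infinity>. ?f x) = 0 - 0"
    by (rule interval_integral_FTC_integrable[where F = ?F])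
       (use deriv cont int poly_shifted_hermite_tendsto_0 in
         \<open>auto simp: einterval_eq_UNIV ereal_tendsto_simps1\<close>)
  then have "hermite_integral b q = 0"
    by (simp add: interval_lebesgue_integral_def einterval_eq_UNIV weight_inner_def)
  then show ?thesis
    by (simp add: q_def hermite_integral_diff)
qed

section \<open>The adjoint of a differential operator\<close>

lemma hermite_integral_higher_pderiv:
  "\<exists>g. \<forall>p. hermite_integral b ((pderiv ^^ j) p * f) = hermite_integral b (p * g)"
proof (induction j arbitrary: f)
  case 0
  show ?case by auto
next
  case (Suc j)
  let ?f' = "[:- 2 * of_real b, 2:] * f - pderiv f"
  have "hermite_integral b ((pderiv ^^ Suc j) p * f) = hermite_integral b ((pderiv ^^ j) p * ?f')" for p
  proof -
    let ?r = "(pderiv ^^ j) p"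
    have "pderiv ?r * f = pderiv (?r * f) - ?r * pderiv f"
      by (simp add: pderiv_mult mult.commute)
    then have "hermite_integral b ((pderiv ^^ Suc j) p * f) =
        hermite_integral b ([:- 2 * of_real b, 2:] * (?r * f) - ?r * pderiv f)"
      by (simp only: funpow.simps o_apply hermite_integral_diff hermite_integral_pderiv)
    also have "[:- 2 * of_real b, 2:] * (?r * f) - ?r * pderiv f = ?r * ?f'"
      by (simp only: right_diff_distrib mult.left_commute)
    finally show ?thesis .
  qed
  with Suc.IH[of ?f'] show ?case by simp
qed

text \<open>The polynomial \<open>g\<close> is the value at \<open>1\<close> of the formal adjoint of \<open>V\<close> with respect to the
  weight. For \<open>n\<close> above its degree, the image under \<open>V\<close> of the \<open>n\<close>-th orthogonal polynomial has no
  component along \<open>1\<close>.\<close>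

lemma hermite_integral_diffop:
  "\<exists>g. \<forall>p. hermite_integral b (p \<bullet>\<^sub>\<Omega> V) = hermite_integral b (p * g)"
proof -
  have "\<forall>j. \<exists>g. \<forall>p. hermite_integral b ((pderiv ^^ j) p * coeff V j) = hermite_integral b (p * g)"
    using hermite_integral_higher_pderiv by blast
  from choice[OF this] obtain g where
    g: "\<And>j p. hermite_integral b ((pderiv ^^ j) p * coeff V j) = hermite_integral b (p * g j)"
    by blast
  have "hermite_integral b (p \<bullet>\<^sub>\<Omega> V) = hermite_integral b (p * (\<Sum>j\<le>degree V. g j))" for p
    unfolding diffop_app_def sum_distrib_left
    by (simp add: weight_inner_sum_left[OF scalar_weight_shifted_hermite] g)
  then show ?thesis by blast
qed

lemma monic_orthogonal_integral_mult_eq_0: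
  assumes w: "scalar_weight I w" and "degree g < n"
  shows "weight_inner I w (monic_orthogonal I w n * g) 1 = 0"
proof -
  have "weight_inner I w (map_poly cnj g) (monic_orthogonal I w n) = 0"
    by (rule is_monic_orthogonal_lower[OF w monic_orthogonal[OF w]])
       (use assms in \<open>auto simp: degree_map_poly\<close>)
  then have "weight_inner I w (monic_orthogonal I w n) (map_poly cnj g) = 0"
    by (subst weight_inner_cnj) simp
  then show ?thesis
    by (subst (asm) weight_inner_eq_mult_1) (simp add: map_poly_map_poly o_def)
qed

section \<open>Shifted Hermite polynomials\<close>

fun hermite_poly :: "real \<Rightarrow> nat \<Rightarrow> complex poly" where
  "hermite_poly b 0 = 1"
| "hermite_poly b (Suc n) = [:- of_real b, 1:] * hermite_poly b n - smult (1 / 2) (pderiv (hermite_poly b n))"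

lemma hermite_poly_monic: "degree (hermite_poly b n) = n \<and> lead_coeff (hermite_poly b n) = 1"
proof (induction n)
  case (Suc n)
  let ?h = "hermite_poly b n"
  have h: "degree ?h = n" "lead_coeff ?h = 1" using Suc by auto
  have nz: "?h \<noteq> 0" using h(2) by auto
  have d: "degree ([:- of_real b, 1:] * ?h) = Suc n"
    using nz h(1) by (subst degree_mult_eq) auto
  have l: "lead_coeff ([:- of_real b, 1:] * ?h) = 1"
    by (subst lead_coeff_mult) (use h in simp)
  have s: "degree (- smult (1 / 2) (pderiv ?h)) < Suc n"
    by (simp add: degree_pderiv h(1))
  have eq: "hermite_poly b (Suc n) = [:- of_real b, 1:] * ?h + - smult (1 / 2) (pderiv ?h)"
    by simp
  show ?case
    unfolding eq using d l s
    by (metis degree_add_eq_left lead_coeff_add_le add.commute)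
qed simp

text \<open>Substituting the recursion and integrating by parts gives
  \<open>L\<^sub>b(h\<^sub>n\<^sub>+\<^sub>1 q) = L\<^sub>b(h\<^sub>n q') / 2\<close>, and differentiation lowers the degree of \<open>q\<close> along with the index.\<close>

lemma hermite_poly_orthogonal:
  assumes "degree q < n"
  shows "hermite_integral b (hermite_poly b n * q) = 0"
  using assms
proof (induction n arbitrary: q)
  case (Suc n)
  let ?h = "hermite_poly b n"
  have "hermite_integral b (hermite_poly b (Suc n) * q) =
      hermite_integral b (smult (1 / 2) ([:- 2 * of_real b, 2:] * (?h * q) - pderiv (?h * q) + ?h * pderiv q))"
    by (rule arg_cong[where f = "hermite_integral b"], rule poly_ext)
       (simp add: pderiv_mult field_simps)
  also have "\<dots> = 1 / 2 * hermite_integral b (?h * pderiv q)"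
    by (simp only: weight_inner_smult_left hermite_integral_add hermite_integral_diff
        hermite_integral_pderiv) simp
  also have "hermite_integral b (?h * pderiv q) = 0"
  proof (cases "degree q = 0")
    case True
    then show ?thesis by (simp add: pderiv_eq_0_iff[THEN iffD2])
  next
    case False
    with Suc.prems show ?thesis by (intro Suc.IH) (simp add: degree_pderiv)
  qed
  finally show ?case by simp
qed simp

lemma monic_orthogonal_shifted_hermite:
  "monic_orthogonal UNIV (shifted_hermite b) = hermite_poly b"
proof -
  let ?w = "shifted_hermite b"
  have less: "weight_inner UNIV ?w (hermite_poly b n) (hermite_poly b m) = 0" if "m < n" for m n
    by (subst weight_inner_eq_mult_1, rule hermite_poly_orthogonal)
       (use that hermite_poly_monic in \<open>auto simp: degree_map_poly\<close>)
  then have "weight_inner UNIV ?w (hermite_poly b m) (hermite_poly b n) = 0" if "m \<noteq> n" for m n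
    using that by (metis complex_cnj_zero linorder_neqE_nat weight_inner_cnj)
  then have "is_monic_orthogonal UNIV ?w (hermite_poly b)"
    unfolding is_monic_orthogonal_def using hermite_poly_monic by blast
  then show ?thesis
    using is_monic_orthogonal_unique monic_orthogonal scalar_weight_shifted_hermite by blast
qed

text \<open>Splitting \<open>x - b = (x - a) + (a - b)\<close> in the recursion isolates a part whose integral against
  \<open>w\<^sub>a\<close> vanishes.\<close>

lemma hermite_integral_hermite_poly:
  "hermite_integral a (hermite_poly b n) = of_real (a - b) ^ n * hermite_integral a 1"
proof (induction n)
  case (Suc n)
  let ?h = "hermite_poly b n"
  have "hermite_poly b (Suc n) =
      smult (1 / 2) ([:- 2 * of_real a, 2:] * ?h - pderiv ?h) + smult (of_real (a - b)) ?h"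
    by (rule poly_ext) (simp add: field_simps)
  then have "hermite_integral a (hermite_poly b (Suc n)) = of_real (a - b) * hermite_integral a ?h"
    by (simp only: weight_inner_smult_left hermite_integral_add hermite_integral_diff
        hermite_integral_pderiv) simp
  with Suc show ?case by simp
qed simp

section \<open>Non-existence of the Darboux transformation\<close>

theorem mainTheorem4:
  fixes a b :: real
  assumes "a \<noteq> b"
  shows "\<not> darboux_transformation UNIV (shifted_hermite a) (shifted_hermite b)"
proof
  let ?P = "monic_orthogonal UNIV (shifted_hermite a)"
  assume "darboux_transformation UNIV (shifted_hermite a) (shifted_hermite b)"
  then obtain V where V: "degree_preserving V" and
    "\<forall>n. \<exists>A. ?P n \<bullet>\<^sub>\<Omega> V = smult A (monic_orthogonal UNIV (shifted_hermite b) n)"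
    unfolding darboux_transformation_def by blast
  then obtain A where A: "\<And>n. ?P n \<bullet>\<^sub>\<Omega> V = smult (A n) (hermite_poly b n)"
    unfolding monic_orthogonal_shifted_hermite by metis
  obtain g where g: "\<And>p. hermite_integral a (p \<bullet>\<^sub>\<Omega> V) = hermite_integral a (p * g)"
    using hermite_integral_diffop by blast
  define n where "n = Suc (degree g)"
  have "A n * hermite_integral a (hermite_poly b n) = hermite_integral a (?P n \<bullet>\<^sub>\<Omega> V)"
    by (simp add: A weight_inner_smult_left)
  also have "\<dots> = 0"
    unfolding g by (rule monic_orthogonal_integral_mult_eq_0[OF scalar_weight_shifted_hermite])
      (simp add: n_def)
  finally have "A n * hermite_integral a (hermite_poly b n) = 0" .
  moreover have "hermite_integral a 1 \<noteq> 0"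
    using weight_inner_self_eq_0[OF scalar_weight_shifted_hermite, of a 1] by auto
  ultimately have "A n = 0"
    using assms by (simp add: hermite_integral_hermite_poly)
  then have "?P n \<bullet>\<^sub>\<Omega> V = 0"
    by (simp add: A)
  moreover have "?P n \<noteq> 0"
    using hermite_poly_monic[of a n] by (auto simp: monic_orthogonal_shifted_hermite)
  ultimately show False
    using V by (auto simp: degree_preserving_def)
qed

end
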